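(* A spectral space $X$ is finite if and only if it is weakly Noetherian and inverse-Noetherian.
   Context: Let $X$ be a spectral space. The inverse (Hochster dual) space $X_{\mathrm{inv}}$ is the same set with the topology having the quasi-compact open subsets of $X$ as a basis of closed subsets. $X$ is inverse-Noetherian if $X_{\mathrm{inv}}$ is a Noetherian topological space. A subset of $X$ is Thomason if it is a union of complements of quasi-compact open subsets of $X$. A subset $V\subseteq X$ is weakly visible if there are Thomason subsets $W_1,W_2\subseteq X$ with $V=W_1\cap(X\setminus W_2)$; a point $x$ is weakly visible if $\{x\}$ is. $X$ is weakly Noetherian if every point of $X$ is weakly visible. *)

theory Defs
  imports "HOL-Analysis.Analysis"
begin

definition quasicompact_openin :: "'a topology \<Rightarrow> 'a set \<Rightarrow> bool" where
  "quasicompact_openin X U \<longleftrightarrow> openin X U \<and> compactin X U"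

definition irreducible_closedin :: "'a topology \<Rightarrow> 'a set \<Rightarrow> bool" where
  "irreducible_closedin X C \<longleftrightarrow>
     closedin X C \<and> C \<noteq> {} \<and>
     (\<forall>A B. closedin X A \<and> closedin X B \<and> C = A \<union> B \<longrightarrow> C = A \<or> C = B)"

definition sober_space :: "'a topology \<Rightarrow> bool" where
  "sober_space X \<longleftrightarrow>
     (\<forall>C. irreducible_closedin X C \<longrightarrow> (\<exists>!x. x \<in> topspace X \<and> X closure_of {x} = C))"

(* Hochster's definition.  The empty space is spectral: it is the spectrum of the zero ring. *)
definition spectral_space :: "'a topology \<Rightarrow> bool" where
  "spectral_space X \<longleftrightarrow>
     compact_space X \<and> t0_space X \<and> sober_space X \<and>
     openin X = arbitrary union_of (quasicompact_openin X) \<and>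
     (\<forall>U V. quasicompact_openin X U \<and> quasicompact_openin X V
        \<longrightarrow> quasicompact_openin X (U \<inter> V))"

definition noetherian_space :: "'a topology \<Rightarrow> bool" where
  "noetherian_space X \<longleftrightarrow>
     (\<forall>C :: nat \<Rightarrow> 'a set. (\<forall>n. closedin X (C n)) \<and> decseq C \<longrightarrow> (\<exists>N. \<forall>n\<ge>N. C n = C N))"

definition coquasicompact_openin :: "'a topology \<Rightarrow> 'a set \<Rightarrow> bool" where
  "coquasicompact_openin X S \<longleftrightarrow> (\<exists>U. quasicompact_openin X U \<and> S = topspace X - U)"

(* The quasi-compact open sets form a basis of closed sets exactly when their complements
   form a basis of open sets.  The lemmas below show that this is a topology on the same
   points for every X, and describe its closed sets. *)
definition inverse_topology :: "'a topology \<Rightarrow> 'a topology" where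
  "inverse_topology X = topology (arbitrary union_of (coquasicompact_openin X))"

lemma istopology_inverse: "istopology (arbitrary union_of (coquasicompact_openin X))"
proof (rule istopology_base)
  fix S T
  assume "coquasicompact_openin X S" "coquasicompact_openin X T"
  then obtain U V where "quasicompact_openin X U" "S = topspace X - U"
    "quasicompact_openin X V" "T = topspace X - V"
    by (auto simp: coquasicompact_openin_def)
  then have "quasicompact_openin X (U \<union> V)" "S \<inter> T = topspace X - (U \<union> V)"
    by (auto simp: quasicompact_openin_def compactin_Un)
  then show "coquasicompact_openin X (S \<inter> T)"
    unfolding coquasicompact_openin_def by blast
qed

lemma openin_inverse_topology:
  "openin (inverse_topology X) = arbitrary union_of (coquasicompact_openin X)"
  by (simp add: inverse_topology_def istopology_inverse)

lemma topspace_inverse_topology [simp]: "topspace (inverse_topology X) = topspace X"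
proof
  show "topspace (inverse_topology X) \<subseteq> topspace X"
    unfolding topspace_def[of "inverse_topology X"] openin_inverse_topology
    by (auto simp: union_of_def coquasicompact_openin_def)
  have "coquasicompact_openin X (topspace X)"
    by (auto simp: coquasicompact_openin_def quasicompact_openin_def intro!: exI[of _ "{}"])
  then have "openin (inverse_topology X) (topspace X)"
    by (simp add: openin_inverse_topology union_of_inc arbitrary_def)
  then show "topspace X \<subseteq> topspace (inverse_topology X)"
    by (rule openin_subset)
qed

lemma closedin_inverse_topology:
  "closedin (inverse_topology X) C \<longleftrightarrow>
     (\<exists>\<U> \<subseteq> Collect (quasicompact_openin X). C = topspace X \<inter> \<Inter>\<U>)"
proof
  assume C: "closedin (inverse_topology X) C"
  then obtain \<S> where S: "\<S> \<subseteq> Collect (coquasicompact_openin X)" "\<Union>\<S> = topspace X - C"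
    by (auto simp: closedin_def openin_inverse_topology union_of_def)
  let ?U = "{U. quasicompact_openin X U \<and> topspace X - U \<in> \<S>}"
  have sub: "C \<subseteq> topspace X"
    using C closedin_subset by fastforce
  have "x \<in> C" if "x \<in> topspace X" "x \<in> \<Inter>?U" for x
  proof (rule ccontr)
    assume "x \<notin> C"
    then obtain T where "T \<in> \<S>" "x \<in> T"
      using S(2) \<open>x \<in> topspace X\<close> by blast
    moreover from this obtain U where "quasicompact_openin X U" "T = topspace X - U"
      using S(1) unfolding coquasicompact_openin_def by blast
    ultimately show False
      using that(2) by auto
  qed
  moreover have "x \<in> \<Inter>?U" if "x \<in> C" for x
    using that sub S(2) by blast
  ultimately have "C = topspace X \<inter> \<Inter>?U"
    using sub by blast
  then show "\<exists>\<U> \<subseteq> Collect (quasicompact_openin X). C = topspace X \<inter> \<Inter>\<U>"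
    by (intro exI[of _ ?U]) auto
next
  assume "\<exists>\<U> \<subseteq> Collect (quasicompact_openin X). C = topspace X \<inter> \<Inter>\<U>"
  then obtain \<U> where U: "\<U> \<subseteq> Collect (quasicompact_openin X)" "C = topspace X \<inter> \<Inter>\<U>"
    by blast
  have "topspace X - C = \<Union>((\<lambda>U. topspace X - U) ` \<U>)"
    using U(2) by blast
  moreover have "(\<lambda>U. topspace X - U) ` \<U> \<subseteq> Collect (coquasicompact_openin X)"
    using U(1) unfolding coquasicompact_openin_def by blast
  ultimately show "closedin (inverse_topology X) C"
    using U(2) unfolding closedin_def openin_inverse_topology union_of_def arbitrary_def
      topspace_inverse_topology
    by blast
qed

definition inverse_noetherian :: "'a topology \<Rightarrow> bool" where
  "inverse_noetherian X \<longleftrightarrow> noetherian_space (inverse_topology X)"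

definition thomason :: "'a topology \<Rightarrow> 'a set \<Rightarrow> bool" where
  "thomason X = arbitrary union_of (coquasicompact_openin X)"

definition weakly_visible :: "'a topology \<Rightarrow> 'a set \<Rightarrow> bool" where
  "weakly_visible X V \<longleftrightarrow>
     (\<exists>W1 W2. thomason X W1 \<and> thomason X W2 \<and> V = W1 \<inter> (topspace X - W2))"

definition weakly_noetherian :: "'a topology \<Rightarrow> bool" where
  "weakly_noetherian X \<longleftrightarrow> (\<forall>x \<in> topspace X. weakly_visible X {x})"

end

theory Submission
  imports Defs
begin

text \<open>
  If the inverse topology is Noetherian, its closed sets are exactly the quasi-compact open sets of
  \<open>X\<close>, and these satisfy the descending chain condition. If \<open>X\<close> is infinite, take a minimal
  infinite quasi-compact open set \<open>U\<close>. For \<open>x \<in> U\<close> weak visibility gives quasi-compact opens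
  \<open>V\<close>, \<open>W\<close> with \<open>{x} = V - W\<close>. If \<open>U \<inter> V\<close> is infinite, then \<open>U \<subseteq> V\<close> by minimality, so that
  \<open>U \<inter> W = U - {x}\<close> is an infinite quasi-compact open set smaller than \<open>U\<close>, a contradiction. So
  every point of \<open>U\<close> has a finite neighbourhood, and \<open>U\<close> is finite by quasi-compactness.
\<close>

text \<open>Stationarity of descending chains makes strict inclusion of closed sets
  well-founded.\<close>

lemma noetherian_space_minimal_closedin:
  assumes "noetherian_space X" "closedin X C" "P C"
  obtains M where "closedin X M" "P M" "\<And>N. closedin X N \<Longrightarrow> P N \<Longrightarrow> N \<subseteq> M \<Longrightarrow> N = M"
proof -
  let ?R = "{(N, M). closedin X N \<and> closedin X M \<and> N \<subset> M}"
  have "wf ?R"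
    unfolding wf_iff_no_infinite_down_chain
  proof
    assume "\<exists>D. \<forall>i. (D (Suc i), D i) \<in> ?R"
    then obtain D where "\<forall>i. (D (Suc i), D i) \<in> ?R" ..
    then have D: "closedin X (D i)" "D (Suc i) \<subset> D i" for i
      by auto
    then have "decseq D"
      by (intro decseq_SucI) blast
    then obtain n where "\<forall>m\<ge>n. D m = D n"
      using D(1) assms(1) unfolding noetherian_space_def by blast
    then show False
      using D(2)[of n] by (metis le_SucI order_refl psubset_eq)
  qed
  then obtain M where "M \<in> {M. closedin X M \<and> P M}"
    and "\<And>N. (N, M) \<in> ?R \<Longrightarrow> N \<notin> {M. closedin X M \<and> P M}"
    using assms by (elim wfE_min[of _ C "{M. closedin X M \<and> P M}"]) auto
  then show thesis
    using that[of M] by blast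
qed

lemma quasicompact_openin_imp_closedin_inverse:
  assumes "quasicompact_openin X U"
  shows "closedin (inverse_topology X) U"
  unfolding closedin_inverse_topology
proof (intro exI conjI)
  show "{U} \<subseteq> Collect (quasicompact_openin X)"
    using assms by blast
  have "U \<subseteq> topspace X"
    using assms openin_subset unfolding quasicompact_openin_def by blast
  then show "U = topspace X \<inter> \<Inter>{U}"
    by blast
qed

text \<open>\<open>C\<close> is an intersection of quasi-compact opens; a minimal quasi-compact open
  set \<open>M\<close> containing \<open>C\<close> already lies in each of them.\<close>

lemma inverse_noetherian_closedin_inverse:
  assumes X: "spectral_space X" "inverse_noetherian X" and C: "closedin (inverse_topology X) C"
  shows "quasicompact_openin X C"
proof -
  obtain \<U> where \<U>: "\<U> \<subseteq> Collect (quasicompact_openin X)" "C = topspace X \<inter> \<Inter>\<U>"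
    using C by (auto simp: closedin_inverse_topology)
  \<comment> \<open>This gives at least one quasi-compact open set containing \<open>C\<close>, so
    that a minimal one exists.\<close>
  have top: "quasicompact_openin X (topspace X)"
  proof -
    have "compact_space X"
      using X(1) unfolding spectral_space_def by (rule conjunct1)
    then show ?thesis
      by (simp add: quasicompact_openin_def compact_space_def)
  qed
  obtain M where M: "quasicompact_openin X M" "C \<subseteq> M"
    and min: "\<And>N. quasicompact_openin X N \<Longrightarrow> C \<subseteq> N \<Longrightarrow> N \<subseteq> M \<Longrightarrow> N = M"
  proof (rule noetherian_space_minimal_closedin[of "inverse_topology X" "topspace X"
        "\<lambda>N. quasicompact_openin X N \<and> C \<subseteq> N"])
    show "noetherian_space (inverse_topology X)"
      using X(2) by (simp add: inverse_noetherian_def)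
    show "closedin (inverse_topology X) (topspace X)"
      using top by (rule quasicompact_openin_imp_closedin_inverse)
    show "quasicompact_openin X (topspace X) \<and> C \<subseteq> topspace X"
      using top \<U>(2) by blast
  qed (use quasicompact_openin_imp_closedin_inverse in blast)
  have "M \<subseteq> U" if "U \<in> \<U>" for U
  proof -
    \<comment> \<open>\<open>M \<inter> U\<close> still contains \<open>C\<close>, so minimality
      forces \<open>M \<inter> U = M\<close>.\<close>
    have "quasicompact_openin X (M \<inter> U)"
      using X(1) M(1) \<U>(1) that unfolding spectral_space_def by blast
    then show ?thesis
      using min[of "M \<inter> U"] M(2) \<U>(2) that by blast
  qed
  moreover have "M \<subseteq> topspace X"
    using M(1) openin_subset by (auto simp: quasicompact_openin_def)
  ultimately have "M = C"
    using M(2) \<U>(2) by blast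
  then show ?thesis
    using M(1) by simp
qed

text \<open>Thomason sets are precisely the open sets of the inverse topology.\<close>

lemma inverse_noetherian_thomason:
  assumes "spectral_space X" "inverse_noetherian X" "thomason X W"
  shows "quasicompact_openin X (topspace X - W)"
proof -
  have "openin (inverse_topology X) W"
    using assms(3) by (simp add: thomason_def openin_inverse_topology)
  then have "closedin (inverse_topology X) (topspace X - W)"
    using closedin_diff[OF closedin_topspace] by fastforce
  with assms(1,2) show ?thesis
    by (rule inverse_noetherian_closedin_inverse)
qed

lemma finite_topspace_if_weakly_inverse_noetherian:
  assumes X: "spectral_space X" and weak: "weakly_noetherian X" and inv: "inverse_noetherian X"
  shows "finite (topspace X)"
proof (rule ccontr)
  assume inf: "infinite (topspace X)"
  obtain U where "closedin (inverse_topology X) U" "infinite U"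
    and min: "\<And>N. closedin (inverse_topology X) N \<Longrightarrow> infinite N \<Longrightarrow> N \<subseteq> U \<Longrightarrow> N = U"
  proof (rule noetherian_space_minimal_closedin[of "inverse_topology X" "topspace X" infinite])
    show "noetherian_space (inverse_topology X)"
      using inv by (simp add: inverse_noetherian_def)
    show "closedin (inverse_topology X) (topspace X)"
      using closedin_topspace[of "inverse_topology X"] by simp
  qed (use inf in auto)
  then have U: "quasicompact_openin X U"
    using X inv inverse_noetherian_closedin_inverse by blast
  have qcI: "quasicompact_openin X (U \<inter> V)" if "quasicompact_openin X V" for V
    using X U that unfolding spectral_space_def by blast
  have nbhd: "\<exists>N. openin X N \<and> finite N \<and> x \<in> N" if x: "x \<in> U" for x
  proof -
    have "x \<in> topspace X"
      using U x openin_subset by (auto simp: quasicompact_openin_def)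
    then obtain W1 W2 where W: "thomason X W1" "thomason X W2" "{x} = W1 \<inter> (topspace X - W2)"
      using weak unfolding weakly_noetherian_def weakly_visible_def by blast
    \<comment> \<open>Complements of \<open>W2\<close> and \<open>W1\<close> are quasi-compact open;
      both are cut down to \<open>U\<close> here, so that \<open>{x} = V - W\<close>.\<close>
    define V where "V = U \<inter> (topspace X - W2)"
    define W where "W = U \<inter> (topspace X - W1)"
    have V: "quasicompact_openin X V" and Wq: "quasicompact_openin X W"
      unfolding V_def W_def using W(1,2) X inv inverse_noetherian_thomason qcI by blast+
    have "finite V"
    proof (rule ccontr)
      assume "infinite V"
      then have "V = U"
        using min V quasicompact_openin_imp_closedin_inverse unfolding V_def by blast
      \<comment> \<open>\<open>V = U\<close> means that \<open>U\<close> misses \<open>W2\<close>,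
        so \<open>W1\<close> meets \<open>U\<close> only in \<open>x\<close>.\<close>
      then have "W = U - {x}"
        using W(3) unfolding V_def W_def by blast
      then have "W = U"
        using min Wq quasicompact_openin_imp_closedin_inverse \<open>infinite U\<close> by fastforce
      then show False
        using \<open>W = U - {x}\<close> x by blast
    qed
    then show ?thesis
      using V W(3) x unfolding V_def quasicompact_openin_def by blast
  qed
  have "U \<subseteq> \<Union>{N. openin X N \<and> finite N}"
    using nbhd by blast
  then obtain \<F> where "finite \<F>" "\<F> \<subseteq> {N. openin X N \<and> finite N}" "U \<subseteq> \<Union>\<F>"
    using U compactinD[of X U "{N. openin X N \<and> finite N}"]
    unfolding quasicompact_openin_def by auto
  then have "finite (\<Union>\<F>)"
    by (intro finite_Union) blast+
  then have "finite U"
    using \<open>U \<subseteq> \<Union>\<F>\<close> by (rule rev_finite_subset)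
  then show False
    using \<open>infinite U\<close> by blast
qed

lemma noetherian_space_if_finite:
  assumes "finite (topspace X)"
  shows "noetherian_space X"
  unfolding noetherian_space_def
proof (intro allI impI)
  fix C :: "nat \<Rightarrow> 'a set"
  assume C: "(\<forall>n. closedin X (C n)) \<and> decseq C"
  have "finite (C n)" for n
    using C assms closedin_subset[of X "C n"] finite_subset by auto
  \<comment> \<open>The chain is stationary from a member of least cardinality on: later members are
    subsets of it and no smaller.\<close>
  define N where "N = (ARG_MIN (card \<circ> C) n. True)"
  have N: "card (C N) \<le> card (C n)" for n
    using arg_min_nat_le[of "\<lambda>_. True" n "card \<circ> C"] by (simp add: N_def)
  have "C n = C N" if "n \<ge> N" for n
  proof (rule card_seteq[OF \<open>finite (C N)\<close> _ N])
    show "C n \<subseteq> C N"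
      using C that by (auto dest: decseqD)
  qed
  then show "\<exists>N. \<forall>n\<ge>N. C n = C N"
    by blast
qed

text \<open>All subsets of a finite space are compact, so every closed set is the complement of a
  quasi-compact open set.\<close>

lemma thomason_if_finite:
  assumes "finite (topspace X)" "\<And>C. C \<in> \<C> \<Longrightarrow> closedin X C"
  shows "thomason X (\<Union>\<C>)"
proof -
  have "coquasicompact_openin X C" if "closedin X C" for C
  proof -
    have "quasicompact_openin X (topspace X - C)"
      using that assms(1) by (auto simp: quasicompact_openin_def intro: finite_imp_compactin)
    then show ?thesis
      using closedin_subset[OF that] unfolding coquasicompact_openin_def
      by (metis double_diff subset_refl)
  qed
  then show ?thesis
    using assms(2) unfolding thomason_def union_of_def arbitrary_def by blast
qed

text \<open>
  In a finite \<open>T\<^sub>0\<close> space, \<open>{x}\<close> is the closure of \<open>x\<close> minus the union of the closed sets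
  avoiding \<open>x\<close>.
\<close>

lemma weakly_noetherian_if_finite:
  assumes "finite (topspace X)" "t0_space X"
  shows "weakly_noetherian X"
  unfolding weakly_noetherian_def weakly_visible_def
proof
  fix x
  assume x: "x \<in> topspace X"
  let ?W1 = "\<Union>{X closure_of {x}}" and ?W2 = "\<Union>{C. closedin X C \<and> x \<notin> C}"
  have "y = x" if y: "y \<in> X closure_of {x}" "y \<in> topspace X" "y \<notin> ?W2" for y
  proof (rule ccontr)
    assume "y \<noteq> x"
    then obtain U where U: "openin X U" "(x \<in> U) \<noteq> (y \<in> U)"
      using assms(2) x y(2) unfolding t0_space_def by blast
    \<comment> \<open>Every open set around \<open>y\<close> contains \<open>x\<close>, so
      \<open>U\<close> can only separate them this way; its complement then puts \<open>y\<close>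
      into \<open>?W2\<close>.\<close>
    then have "x \<in> U" "y \<notin> U"
      using y(1) by (auto simp: in_closure_of)
    then show False
      using y(2,3) U(1) by blast
  qed
  moreover have "x \<in> X closure_of {x}" "x \<notin> ?W2"
    using x by (auto simp: in_closure_of)
  ultimately have "{x} = ?W1 \<inter> (topspace X - ?W2)"
    using x by auto
  moreover have "thomason X ?W1" "thomason X ?W2"
    by (rule thomason_if_finite[OF assms(1)]; auto)+
  ultimately show "\<exists>W1 W2. thomason X W1 \<and> thomason X W2 \<and> {x} = W1 \<inter> (topspace X - W2)"
    by blast
qed

theorem lemma3:
  fixes X :: "'a topology"
  assumes "spectral_space X"
  shows "finite (topspace X) \<longleftrightarrow> weakly_noetherian X \<and> inverse_noetherian X"
proof
  assume fin: "finite (topspace X)"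
  show "weakly_noetherian X \<and> inverse_noetherian X"
    using weakly_noetherian_if_finite[OF fin] noetherian_space_if_finite[of "inverse_topology X"]
      fin assms
    by (simp add: spectral_space_def inverse_noetherian_def)
qed (use assms finite_topspace_if_weakly_inverse_noetherian in blast)

end
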